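(* Let $n$ be a positive integer and let $m$ be the largest odd divisor of $n$. Let $sc_o(n)$ (resp. $sc_e(n)$) denote the sum of the smallest parts of all partitions of $n$ into an odd (resp. even) number of distinct consecutive parts. Then \[sc_o(n) - sc_e(n) = \frac{1}{2}\Big(\sigma(n) + \#\{t \mid m : t < \sqrt{2n}\} - \#\{t \mid m : t > \sqrt{2n}\}\Big),\] where $\sigma(n)$ is the sum of the positive divisors of $n$ and $t$ ranges over positive divisors of $m$.
   Context: A partition of $n$ into distinct consecutive parts is a representation $n = c + (c+1) + \cdots + (c+\ell-1)$ with $c \ge 1$, $\ell \ge 1$ (so the one-part partition $n$ itself counts, with $\ell = 1$); its number of parts is $\ell$ and its smallest part is $c$. *)

theory Defs
  imports Complex_Main
begin

text \<open>The pair \<open>(c, l)\<close> encodes the partition \<open>c + (c + 1) + \<dots> + (c + l - 1)\<close>, with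
  smallest part \<open>c\<close> and \<open>l\<close> parts. The pair is determined by the set of parts.\<close>

definition consecutive_partitions :: "nat \<Rightarrow> (nat \<times> nat) set" where
  "consecutive_partitions n = {(c, l). c \<ge> 1 \<and> l \<ge> 1 \<and> n = (\<Sum>i<l. c + i)}"

lemma finite_consecutive_partitions: "finite (consecutive_partitions n)"
proof (rule finite_subset)
  show "consecutive_partitions n \<subseteq> {..n} \<times> {..n}"
  proof (clarsimp simp: consecutive_partitions_def simp del: sum.distrib)
    fix c l :: nat
    assume c: "Suc 0 \<le> c" and l: "Suc 0 \<le> l"
    have "c + 0 \<le> (\<Sum>i<l. c + i)"
      by (rule member_le_sum) (use l in auto)
    moreover have "(\<Sum>i<l. 1) \<le> (\<Sum>i<l. c + i)"
      by (rule sum_mono) (use c in auto)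
    ultimately show "c \<le> (\<Sum>i<l. c + i) \<and> l \<le> (\<Sum>i<l. c + i)"
      by simp
  qed
qed auto

definition sc_o :: "nat \<Rightarrow> nat" where
  "sc_o n = (\<Sum>(c, l) \<in> {(c, l) \<in> consecutive_partitions n. odd l}. c)"

definition sc_e :: "nat \<Rightarrow> nat" where
  "sc_e n = (\<Sum>(c, l) \<in> {(c, l) \<in> consecutive_partitions n. even l}. c)"

text \<open>Used for positive \<open>n\<close> only; then the set of divisors is finite and nonempty.\<close>

definition largest_odd_divisor :: "nat \<Rightarrow> nat" where
  "largest_odd_divisor n = Max {d. d dvd n \<and> odd d}"

definition divisor_sigma :: "nat \<Rightarrow> nat" where
  "divisor_sigma n = (\<Sum>d | d dvd n. d)"

end

theory Submission
  imports Defs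
begin

text \<open>A partition into \<open>l\<close> consecutive parts starting at \<open>c\<close> is a factorisation
  \<open>2 * n = l * s\<close> with \<open>s = 2 * c + l - 1 > l\<close>, whose factors have opposite parity. Its odd factor
  \<open>t\<close> is an odd divisor of \<open>n\<close>: it is \<open>l\<close> if \<open>l\<close> is odd, in which case \<open>t\<^sup>2 < 2 * n\<close>, and \<open>s\<close>
  otherwise, in which case \<open>t\<^sup>2 > 2 * n\<close>. Every odd divisor of \<open>n\<close> arises exactly once, and
  \<open>2 * c\<close> is \<open>(2 * n / t - t) + 1\<close> in the first case and \<open>- (2 * n / t - t) + 1\<close> in the
  second, so the signed sum is half of \<open>\<Sum>t. 2 * n / t - t\<close> plus the difference of the counts.
  The former is the sum of all divisors of \<open>n\<close>, as one sees by splitting the divisors \<open>d\<close> of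
  \<open>2 * n\<close> once by the parity of \<open>d\<close> and once by the parity of \<open>2 * n / d\<close>.\<close>

lemma sum_consecutive: "2 * (\<Sum>i<l. c + i) + l = l * (2 * c + l)" for c l :: nat
  by (induction l) (auto simp: algebra_simps)

lemma mem_consecutive_partitions_iff:
  "(c, l) \<in> consecutive_partitions n \<longleftrightarrow> c \<ge> 1 \<and> l \<ge> 1 \<and> 2 * n = l * (2 * c + l - 1)"
proof -
  \<comment> \<open>For \<open>c \<ge> 1\<close> the truncated subtraction is exact, so adding
    \<open>l\<close> to both sides reduces the claim to \<open>sum_consecutive\<close>.\<close>
  have "l * (2 * c + l - 1) + l = l * (2 * c + l)" if "c \<ge> 1"
    using that by (cases c) (auto simp: algebra_simps)
  then show ?thesis
    using sum_consecutive[of c l] unfolding consecutive_partitions_def by auto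
qed

text \<open>The lcm of two odd divisors of \<open>n\<close> divides their odd product, so it is
  again an odd divisor of \<open>n\<close>. By maximality its value with
  \<open>largest_odd_divisor n\<close> cannot exceed the latter.\<close>

lemma dvd_largest_odd_divisor_iff:
  assumes "n > 0"
  shows "t dvd largest_odd_divisor n \<longleftrightarrow> odd t \<and> t dvd n"
proof -
  let ?D = "{d. d dvd n \<and> odd d}"
  let ?m = "largest_odd_divisor n"
  have fin: "finite ?D"
    using assms by simp
  have "?m \<in> ?D"
    unfolding largest_odd_divisor_def using fin by (rule Max_in) (auto intro: exI[of _ 1])
  then have m: "?m dvd n" "odd ?m"
    by auto
  have "t dvd ?m" if t: "odd t" "t dvd n"
  proof -
    have "lcm t ?m dvd t * ?m"
      by (simp add: lcm_least)
    then have "odd (lcm t ?m)"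
      using t m by (meson dvd_trans even_mult_iff)
    then have "lcm t ?m \<in> ?D"
      using t m by simp
    then have "lcm t ?m \<le> ?m"
      unfolding largest_odd_divisor_def[of n] using fin by (rule Max_ge[rotated])
    moreover have "?m \<le> lcm t ?m"
      using \<open>odd (lcm t ?m)\<close> by (intro dvd_imp_le) (auto intro: odd_pos)
    ultimately show ?thesis
      by (metis dvd_lcm1 le_antisym)
  qed
  then show ?thesis
    using m by (auto intro: dvd_trans)
qed

lemma odd_dvd_double_iff:
  fixes t n :: nat
  assumes "odd t"
  shows "t dvd 2 * n \<longleftrightarrow> t dvd n"
proof -
  have "coprime t 2"
    using assms by simp
  then show ?thesis
    by (rule coprime_dvd_mult_right_iff)
qed

lemma sum_divisors_double_minus_odd:
  assumes "n > 0"
  shows "(\<Sum>t | odd t \<and> t dvd n. 2 * real n / real t - real t) = real (divisor_sigma n)"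
proof -
  have fin: "finite {d. d dvd 2 * n}"
    using assms by simp
  \<comment> \<open>Halving maps the even divisors of \<open>2 * n\<close> bijectively onto the
    divisors of \<open>n\<close>.\<close>
  have even_part: "(\<Sum>d | d dvd 2 * n \<and> even d. d) = 2 * divisor_sigma n"
    unfolding divisor_sigma_def sum_distrib_left
    by (rule sum.reindex_bij_witness[of _ "\<lambda>d. 2 * d" "\<lambda>d. d div 2"]) auto
  have "(\<Sum>d | d dvd 2 * n. d) = (\<Sum>d | d dvd 2 * n \<and> even d. d) + (\<Sum>d | d dvd 2 * n \<and> odd d. d)"
    using fin by (subst sum.union_disjoint[symmetric]) (auto intro!: sum.cong)
  also have "{d. d dvd 2 * n \<and> odd d} = {t. odd t \<and> t dvd n}"
    by (auto simp: odd_dvd_double_iff)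
  finally have 1: "(\<Sum>d | d dvd 2 * n. d) = 2 * divisor_sigma n + (\<Sum>t | odd t \<and> t dvd n. t)"
    using even_part by simp
  \<comment> \<open>Second splitting: a divisor of \<open>2 * n\<close> divides \<open>n\<close>
    exactly when its cofactor is even.\<close>
  have "(\<Sum>d | d dvd 2 * n. d) = (\<Sum>d | d dvd n. d) + (\<Sum>d | d dvd 2 * n \<and> \<not> d dvd n. d)"
    using fin assms by (subst sum.union_disjoint[symmetric]) (auto intro!: sum.cong)
  also have "(\<Sum>d | d dvd 2 * n \<and> \<not> d dvd n. d) = (\<Sum>t | odd t \<and> t dvd n. 2 * n div t)"
  proof (rule sum.reindex_bij_witness[of _ "\<lambda>t. 2 * n div t" "\<lambda>d. 2 * n div d"])
    fix d assume d: "d \<in> {d. d dvd 2 * n \<and> \<not> d dvd n}"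
    then obtain e where e: "2 * n = d * e" by (auto elim: dvdE)
    have "odd e"
    proof
      assume "even e"
      then obtain f where "e = 2 * f" ..
      with e have "n = d * f" by simp
      with d show False by simp
    qed
    moreover from e have "e dvd 2 * n" by simp
    ultimately have "e dvd n" by (simp add: odd_dvd_double_iff)
    moreover have "2 * n div d = e" "2 * n div e = d"
      using e assms by auto
    ultimately show "2 * n div (2 * n div d) = d" "2 * n div d \<in> {t. odd t \<and> t dvd n}"
      "2 * n div (2 * n div d) = d"
      using \<open>odd e\<close> by auto
  next
    fix t assume t: "t \<in> {t. odd t \<and> t dvd n}"
    then obtain e where e: "n = t * e" by (auto elim: dvdE)
    \<comment> \<open>Cancelling \<open>e\<close>, which is positive since \<open>n > 0\<close>,
      would leave \<open>2\<close> dividing the odd \<open>t\<close>.\<close>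
    have "\<not> 2 * e dvd t * e"
      using t e assms by auto
    then show "2 * n div (2 * n div t) = t" "2 * n div t \<in> {d. d dvd 2 * n \<and> \<not> d dvd n}"
      using e assms by auto
  qed
  finally have "divisor_sigma n + (\<Sum>t | odd t \<and> t dvd n. t) = (\<Sum>t | odd t \<and> t dvd n. 2 * n div t)"
    using 1 unfolding divisor_sigma_def by simp
  from arg_cong[OF this, of real] have "real (divisor_sigma n) + (\<Sum>t | odd t \<and> t dvd n. real t)
      = (\<Sum>t | odd t \<and> t dvd n. real (2 * n div t))"
    by (simp only: of_nat_add of_nat_sum)
  also have "\<dots> = (\<Sum>t | odd t \<and> t dvd n. 2 * real n / real t)"
    by (intro sum.cong refl) (auto simp: real_of_nat_div)
  finally show ?thesis
    by (simp add: sum_subtractf)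
qed

lemma sc_o_eq:
  "real (sc_o n) =
    (\<Sum>t | odd t \<and> t dvd n \<and> t * t < 2 * n. (2 * real n / real t - real t + 1) / 2)"
  unfolding sc_o_def of_nat_sum
\<comment> \<open>Here \<open>t\<close> is the number of parts; the first component solves
  \<open>2 * n div t = 2 * c + t - 1\<close> for \<open>c\<close>.\<close>
proof (rule sum.reindex_bij_witness[of _ "\<lambda>t. ((2 * n div t + 1 - t) div 2, t)" snd])
  fix p assume "p \<in> {(c, l). (c, l) \<in> consecutive_partitions n \<and> odd l}"
  then obtain c l where p: "p = (c, l)" and c: "c \<ge> 1" and l: "odd l"
    and n: "2 * n = l * (2 * c + l - 1)"
    by (auto simp: mem_consecutive_partitions_iff)
  have l0: "l > 0" using l by (simp add: odd_pos)
  have div: "2 * n div l = 2 * c + l - 1"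
    unfolding n using l0 by simp
  show "((2 * n div snd p + 1 - snd p) div 2, snd p) = p"
    using div p c by simp
  have "l dvd 2 * n" by (simp add: n)
  then have "l dvd n" using l by (simp add: odd_dvd_double_iff)
  moreover have "l * l < 2 * n"
    unfolding n using c l0 by simp
  ultimately show "snd p \<in> {t. odd t \<and> t dvd n \<and> t * t < 2 * n}"
    using p l by simp
  have "2 * real n = real l * (2 * real c + real l - 1)"
    using arg_cong[OF n, of real] c by (simp add: of_nat_diff)
  then show "(2 * real n / real (snd p) - real (snd p) + 1) / 2 = real (case p of (c, l) \<Rightarrow> c)"
    using p l0 by simp
next
  fix t assume t: "t \<in> {t. odd t \<and> t dvd n \<and> t * t < 2 * n}"
  then obtain e where e: "n = t * e" by (auto elim: dvdE)
  have t0: "t > 0" using t by (simp add: odd_pos)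
  have "t * t < t * (2 * e)" using t e by simp
  then have lt: "t < 2 * e" by simp
  \<comment> \<open>With \<open>t = 2 * b + 1\<close> the halving is exact: the smallest part is
    \<open>e - b\<close>, positive because \<open>t < 2 * e\<close>.\<close>
  obtain b where b: "t = 2 * b + 1" using t by (auto elim: oddE)
  have "2 * n div t = 2 * e" using e t0 by simp
  then have "(2 * n div t + 1 - t) div 2 = e - b" "e > b"
    using lt b by auto
  moreover have "2 * (e - b) + t - 1 = 2 * e" using \<open>e > b\<close> b by simp
  ultimately show "((2 * n div t + 1 - t) div 2, t) \<in> {(c, l). (c, l) \<in> consecutive_partitions n \<and> odd l}"
    using t e t0 by (simp add: mem_consecutive_partitions_iff)
qed simp

text \<open>For even \<open>l\<close> the odd factor is \<open>2 * c + l - 1\<close>, the sum of the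
  smallest and the largest part. From this \<open>t\<close> the number of parts is recovered as
  \<open>2 * n div t\<close>, and then \<open>c\<close> as half of \<open>t + 1 - l\<close>.\<close>

lemma sc_e_eq:
  assumes "n > 0"
  shows "real (sc_e n) =
    (\<Sum>t | odd t \<and> t dvd n \<and> 2 * n < t * t. (real t - 2 * real n / real t + 1) / 2)"
  unfolding sc_e_def of_nat_sum
proof (rule sum.reindex_bij_witness[of _ "\<lambda>t. ((t + 1 - 2 * n div t) div 2, 2 * n div t)"
      "\<lambda>(c, l). 2 * c + l - 1"])
  let ?s = "\<lambda>(c, l). 2 * c + l - 1 :: nat"
  fix p assume "p \<in> {(c, l). (c, l) \<in> consecutive_partitions n \<and> even l}"
  then obtain c l where p: "p = (c, l)" and c: "c \<ge> 1" and l: "even l" "l \<ge> 1"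
    and n: "2 * n = l * (2 * c + l - 1)"
    by (auto simp: mem_consecutive_partitions_iff)
  define t where "t = 2 * c + l - 1"
  have t: "odd t" "l < t" "t + 1 = 2 * c + l" "?s p = t"
    using c l p by (auto simp: t_def)
  have n: "2 * n = l * t" using n t_def by simp
  have div: "2 * n div t = l"
    unfolding n using t by simp
  show "((?s p + 1 - 2 * n div ?s p) div 2, 2 * n div ?s p) = p"
    unfolding t(4) div t(3) by (simp add: p)
  have "t dvd 2 * n" by (simp add: n)
  then have "t dvd n" using t by (simp add: odd_dvd_double_iff)
  moreover have "2 * n < t * t"
    unfolding n using t by simp
  ultimately show "?s p \<in> {t. odd t \<and> t dvd n \<and> 2 * n < t * t}"
    unfolding t(4) using t by simp
  have "2 * real n = real l * real t" "real t + 1 = 2 * real c + real l"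
    using arg_cong[OF n, of real] arg_cong[OF t(3), of real] by simp_all
  then show "(real (?s p) - 2 * real n / real (?s p) + 1) / 2 = real (case p of (c, l) \<Rightarrow> c)"
    unfolding t(4) using p t(2) by simp
next
  fix t assume t: "t \<in> {t. odd t \<and> t dvd n \<and> 2 * n < t * t}"
  then obtain e where e: "n = t * e" by (auto elim: dvdE)
  have t0: "t > 0" using t by (simp add: odd_pos)
  have "t * (2 * e) < t * t" using t e by simp
  then have lt: "2 * e < t" by simp
  \<comment> \<open>Positivity of \<open>n\<close> ensures that the number of parts
    \<open>2 * e\<close> is nonzero.\<close>
  have e0: "e > 0" using e assms by (cases e) auto
  obtain b where b: "t = 2 * b + 1" using t by (auto elim: oddE)
  have div: "2 * n div t = 2 * e" using e t0 by simp
  have c: "(t + 1 - 2 * e) div 2 = b + 1 - e" "b + 1 > e"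
    using lt b by auto
  moreover have s: "2 * (b + 1 - e) + 2 * e - 1 = t" using c b by simp
  ultimately show "((t + 1 - 2 * n div t) div 2, 2 * n div t)
      \<in> {(c, l). (c, l) \<in> consecutive_partitions n \<and> even l}"
    unfolding div using e e0 by (simp add: mem_consecutive_partitions_iff)
  show "(case ((t + 1 - 2 * n div t) div 2, 2 * n div t) of (c, l) \<Rightarrow> 2 * c + l - 1) = t"
    unfolding div c(1) using s by simp
qed

theorem theorem5:
  fixes n m :: nat
  assumes "n > 0"
    and "m = largest_odd_divisor n"
  shows "real (sc_o n) - real (sc_e n) =
    1 / 2 * (real (divisor_sigma n)
      + real (card {t. t dvd m \<and> real t < sqrt (2 * real n)})
      - real (card {t. t dvd m \<and> real t > sqrt (2 * real n)}))"
proof -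
  let ?f = "\<lambda>t. 2 * real n / real t - real t"
  let ?L = "{t. odd t \<and> t dvd n \<and> t * t < 2 * n}"
  let ?G = "{t. odd t \<and> t dvd n \<and> 2 * n < t * t}"
  have less: "real t < sqrt (2 * real n) \<longleftrightarrow> t * t < 2 * n" for t
  proof -
    have "real t < sqrt (2 * real n) \<longleftrightarrow> (real t)\<^sup>2 < 2 * real n"
      by (metis of_nat_0_le_iff real_less_rsqrt real_sqrt_less_iff real_sqrt_unique)
    also have "\<dots> \<longleftrightarrow> real (t * t) < real (2 * n)"
      by (simp add: power2_eq_square)
    finally show ?thesis by (simp only: of_nat_less_iff)
  qed
  have greater: "real t > sqrt (2 * real n) \<longleftrightarrow> 2 * n < t * t" for t
  proof -
    have "real t > sqrt (2 * real n) \<longleftrightarrow> (real t)\<^sup>2 > 2 * real n"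
      by (metis of_nat_0_le_iff real_sqrt_less_iff real_sqrt_unique)
    also have "\<dots> \<longleftrightarrow> real (t * t) > real (2 * n)"
      by (simp add: power2_eq_square)
    finally show ?thesis by (simp only: of_nat_less_iff)
  qed
  have fin: "finite {t. odd t \<and> t dvd n}"
    using assms(1) by simp
  \<comment> \<open>An odd square is never \<open>2 * n\<close>, so no odd divisor falls between
    \<open>?L\<close> and \<open>?G\<close>.\<close>
  have "t * t \<noteq> 2 * n" if "odd t" for t
    using that by (metis dvd_triv_left even_mult_iff)
  then have split: "{t. odd t \<and> t dvd n} = ?L \<union> ?G"
    by (auto simp: linorder_neq_iff)
  have "real (divisor_sigma n) = sum ?f (?L \<union> ?G)"
    unfolding split[symmetric] using sum_divisors_double_minus_odd[OF assms(1)] by (rule sym)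
  also have "\<dots> = sum ?f ?L + sum ?f ?G"
    by (rule sum.union_disjoint) (auto intro: finite_subset[OF _ fin])
  finally have sigma: "real (divisor_sigma n) = sum ?f ?L + sum ?f ?G" .
  have "2 * real (sc_o n) = (\<Sum>t\<in>?L. ?f t + 1)"
    unfolding sc_o_eq sum_distrib_left by (intro sum.cong) auto
  also have "\<dots> = sum ?f ?L + real (card ?L)"
    by (simp only: sum.distrib) simp
  finally have o: "2 * real (sc_o n) = sum ?f ?L + real (card ?L)" .
  \<comment> \<open>On \<open>?G\<close> the function \<open>?f\<close> enters negated, so
    subtraction restores its sign and the two sums combine to \<open>divisor_sigma n\<close>; the
    constant \<open>1\<close> keeps its sign, which produces the difference of
    cardinalities.\<close>
  have "2 * real (sc_e n) = (\<Sum>t\<in>?G. - ?f t + 1)"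
    unfolding sc_e_eq[OF assms(1)] sum_distrib_left by (intro sum.cong) auto
  also have "\<dots> = - sum ?f ?G + real (card ?G)"
    by (simp only: sum.distrib sum_negf) simp
  finally have e: "2 * real (sc_e n) = - sum ?f ?G + real (card ?G)" .
  show ?thesis
    unfolding assms(2) dvd_largest_odd_divisor_iff[OF assms(1)] less greater conj_assoc
    using o e sigma by simp
qed

end
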